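(* Let $n\ge 2$, $q\ge 2$, and let $\mathcal A$ be a set of size $q$. Let $A_1,\dots,A_{n-1}$ be a partition of $\mathcal A$ into nonempty sets, and let $(C,\overline C)$ be a partition of $\mathcal A^2$ into two nonempty sets such that $|C\cap K|/|K|$ is the same for all sets $K$ of the form $\{a\}\times\mathcal A$ ($a\in \mathcal A$) or $A_i\times\{b\}$ ($1\le i\le n-1$, $b\in\mathcal A$). Let $$C^+=\{(x_1,x_2,y_3,\dots,y_n):(x_1,x_2)\in C,\ y_3,\dots,y_n\in\mathcal A\}\subseteq\mathcal A^n,$$ and $$C^+_\pi=\bigcup_{i=1}^{n-1}\pi_i\big((A_i\times\mathcal A^{n-1})\cap C^+\big),$$ where $\pi_i$ is the map on $\mathcal A^n$ interchanging the coordinates in positions $2$ and $i+1$ ($\pi_1$ is the identity). Then $(C^+_\pi,\overline{C^+_\pi})$ is an equitable $2$-partition of $H(n,q)$ with the same quotient matrix as that of the equitable $2$-partition $(C^+,\overline{C^+})$ of $H(n,q)$, and with eigenvalue $\lambda_2(n,q)=(q-1)n-2q$.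
   Context: The Hamming graph $H(n,q)$ has vertex set $\mathcal A^n$, $|\mathcal A|=q$, two tuples being adjacent iff they differ in exactly one coordinate. A partition $(C_1,C_2)$ of the vertex set of a graph into two nonempty cells is equitable with quotient matrix $S=(S_{ij})_{i,j\in\{1,2\}}$ if every vertex of $C_i$ has exactly $S_{ij}$ neighbours in $C_j$ for all $i,j$. An eigenvalue of the partition is an eigenvalue of $S$; for a $k$-regular graph these are $k$ and $S_{11}-S_{21}$, and "with eigenvalue $\lambda$" means $S_{11}-S_{21}=\lambda$. Overlines denote complements in the respective vertex set. *)

theory Defs
  imports "HOL-Analysis.Cartesian_Space" "HOL-Library.FuncSet" "HOL-Library.Disjoint_Sets"
    "HOL-Combinatorics.Transposition"
begin

text \<open>Tuples in \<open>A\<^sup>n\<close> are functions on the positions \<open>1, \<dots>, n\<close>, extended by \<^const>\<open>undefined\<close>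
  outside, so that equality of tuples is equality of functions.\<close>

definition tuples :: "nat \<Rightarrow> 'a set \<Rightarrow> (nat \<Rightarrow> 'a) set" where
  "tuples n A = {1..n} \<rightarrow>\<^sub>E A"

definition hamming_adj :: "nat \<Rightarrow> (nat \<Rightarrow> 'a) \<Rightarrow> (nat \<Rightarrow> 'a) \<Rightarrow> bool" where
  "hamming_adj n x y \<longleftrightarrow> (\<exists>!i. i \<in> {1..n} \<and> x i \<noteq> y i)"

text \<open>A graph is given by its vertex set and its adjacency relation.  The cells and the entries of
  the quotient matrix are indexed by the two-element type \<^typ>\<open>2\<close>, whose elements are \<open>1\<close> and
  \<open>2\<close>.\<close>

definition cell :: "'v set \<Rightarrow> 'v set \<Rightarrow> 2 \<Rightarrow> 'v set" where
  "cell C1 C2 i = (if i = 1 then C1 else C2)"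

definition equitable_2_partition ::
    "'v set \<Rightarrow> ('v \<Rightarrow> 'v \<Rightarrow> bool) \<Rightarrow> 'v set \<Rightarrow> 'v set \<Rightarrow> real^2^2 \<Rightarrow> bool" where
  "equitable_2_partition V adj C1 C2 S \<longleftrightarrow>
     C1 \<noteq> {} \<and> C2 \<noteq> {} \<and> C1 \<inter> C2 = {} \<and> C1 \<union> C2 = V \<and>
     (\<forall>i j. \<forall>v \<in> cell C1 C2 i. real (card {w \<in> cell C1 C2 j. adj v w}) = S $ i $ j)"

text \<open>For a regular graph of degree \<open>k\<close> both rows of the quotient matrix sum to \<open>k\<close>, so its
  eigenvalues are \<open>k\<close> and the number below, which is called the eigenvalue of the partition.\<close>

definition partition_eigenvalue :: "real^2^2 \<Rightarrow> real" where
  "partition_eigenvalue S = S $ 1 $ 1 - S $ 2 $ 1"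

definition C_plus :: "nat \<Rightarrow> 'a set \<Rightarrow> ('a \<times> 'a) set \<Rightarrow> (nat \<Rightarrow> 'a) set" where
  "C_plus n A C = {x \<in> tuples n A. (x 1, x 2) \<in> C}"

definition coord_swap :: "nat \<Rightarrow> (nat \<Rightarrow> 'a) \<Rightarrow> (nat \<Rightarrow> 'a)" where
  "coord_swap i x = x \<circ> Transposition.transpose 2 (i + 1)"

text \<open>Below, \<^term>\<open>{x \<in> tuples n A. x 1 \<in> P i}\<close> is the product \<open>P i \<times> A\<^sup>n\<^sup>-\<^sup>1\<close>.\<close>

definition C_plus_pi ::
    "nat \<Rightarrow> 'a set \<Rightarrow> (nat \<Rightarrow> 'a set) \<Rightarrow> ('a \<times> 'a) set \<Rightarrow> (nat \<Rightarrow> 'a) set" where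
  "C_plus_pi n A P C =
     (\<Union>i\<in>{1..n-1}. coord_swap i ` ({x \<in> tuples n A. x 1 \<in> P i} \<inter> C_plus n A C))"

end

theory Submission imports Defs begin

text \<open>Both sets have the form \<open>{x. (x\<^sub>1, x\<^bsub>\<tau>(x\<^sub>1)\<^esub>) \<in> C}\<close> for a map \<open>\<tau>\<close> from the alphabet to the positions
  \<open>2, \<dots>, n\<close>: for \<open>C\<^sup>+\<close> it is constantly \<open>2\<close>, and for the switched set it is \<open>i + 1\<close> on \<open>A\<^sub>i\<close>.
  A position other than \<open>1\<close> and \<open>\<tau>(x\<^sub>1)\<close> does not affect the membership of \<open>x\<close>, while varying either
  of these two positions over the alphabet meets the set exactly \<open>k\<close> times, where \<open>k/q\<close> is the
  density of \<open>C\<close>; for position \<open>1\<close> this is the sum of the densities over the sets \<open>A\<^sub>i \<times> {x\<^bsub>i+1\<^esub>}\<close>.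
  So the numbers of neighbours depend only on \<open>n\<close>, \<open>q\<close> and \<open>k\<close>.\<close>

definition twisted_lift :: "nat \<Rightarrow> 'a set \<Rightarrow> ('a \<Rightarrow> nat) \<Rightarrow> ('a \<times> 'a) set \<Rightarrow> (nat \<Rightarrow> 'a) set" where
  "twisted_lift n A \<tau> C = {x \<in> tuples n A. (x 1, x (\<tau> (x 1))) \<in> C}"

text \<open>From a vertex in the first cell, positions 1 and \<open>\<tau>\<close> of the first
  letter each lead to \<open>k - 1\<close> further members, as the vertex itself is one of the
  \<open>k\<close> hits, and the other \<open>n - 2\<close> positions to \<open>q - 1\<close> each.
  From outside, only those two positions count, with \<open>k\<close> each. The second column
  completes the row to the degree \<open>n * (q - 1)\<close>.\<close>

definition quotient_matrix :: "nat \<Rightarrow> nat \<Rightarrow> nat \<Rightarrow> real^2^2" where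
  "quotient_matrix n q k =
     (\<chi> i j. let s = (if i = 1 then 2 * (real k - 1) + (real n - 2) * (real q - 1) else 2 * real k)
             in if j = 1 then s else real n * (real q - 1) - s)"

section \<open>Neighbourhoods in the Hamming graph\<close>

lemma tuples_upd: "x \<in> tuples n A \<Longrightarrow> i \<in> {1..n} \<Longrightarrow> a \<in> A \<Longrightarrow> x(i := a) \<in> tuples n A"
  by (auto simp: tuples_def PiE_iff extensional_def)

lemma tuples_in: "x \<in> tuples n A \<Longrightarrow> i \<in> {1..n} \<Longrightarrow> x i \<in> A"
  by (auto simp: tuples_def)

lemma finite_tuples: "finite A \<Longrightarrow> finite (tuples n A)"
  by (simp add: tuples_def finite_PiE)

lemma neighbours_eq:
  assumes x: "x \<in> tuples n A" and W: "W \<subseteq> tuples n A"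
  shows "{w \<in> W. hamming_adj n x w} =
    (\<lambda>(i, a). x(i := a)) ` (SIGMA i:{1..n}. {a \<in> A - {x i}. x(i := a) \<in> W})"
proof (intro equalityI subsetI)
  fix w assume "w \<in> {w \<in> W. hamming_adj n x w}"
  then have w: "w \<in> W" "w \<in> tuples n A" and "hamming_adj n x w"
    using W by auto
  then obtain i where i: "i \<in> {1..n}" "x i \<noteq> w i"
    and u: "\<forall>j. j \<in> {1..n} \<and> x j \<noteq> w j \<longrightarrow> j = i"
    unfolding hamming_adj_def Ex1_def by blast
  have "w j = (x(i := w i)) j" for j
  proof (cases "j \<in> {1..n}")
    case True
    then show ?thesis using u by (cases "j = i") (simp, metis fun_upd_other)
  next
    case False
    \<comment> \<open>Outside \<open>{1..n}\<close> both tuples have the value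
      \<open>undefined\<close>.\<close>
    then have "x j = w j" "j \<noteq> i"
      using x w(2) i(1) PiE_arb[of _ "{1..n}" "\<lambda>_. A" j] unfolding tuples_def by auto
    then show ?thesis by simp
  qed
  then have "w = x(i := w i)" by blast
  moreover have "w i \<in> A" using w(2) i(1) by (rule tuples_in)
  ultimately show "w \<in> (\<lambda>(i, a). x(i := a)) ` (SIGMA i:{1..n}. {a \<in> A - {x i}. x(i := a) \<in> W})"
    using i w(1) by (intro image_eqI[where x = "(i, w i)"]) auto
next
  fix w assume "w \<in> (\<lambda>(i, a). x(i := a)) ` (SIGMA i:{1..n}. {a \<in> A - {x i}. x(i := a) \<in> W})"
  then obtain i a where "i \<in> {1..n}" "a \<noteq> x i" "w = x(i := a)" "w \<in> W" by auto
  then show "w \<in> {w \<in> W. hamming_adj n x w}"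
    by (auto simp: hamming_adj_def split: if_splits)
qed

text \<open>The changed position and the new letter can be recovered from the neighbour, because the
  new letter differs from \<open>x i\<close>; so counting position by position counts no neighbour
  twice.\<close>

lemma card_neighbours:
  assumes x: "x \<in> tuples n A" and W: "W \<subseteq> tuples n A" and A: "finite A"
  shows "card {w \<in> W. hamming_adj n x w} =
    (\<Sum>i\<in>{1..n}. card {a \<in> A - {x i}. x(i := a) \<in> W})"
proof -
  have "inj_on (\<lambda>(i, a). x(i := a)) (SIGMA i:{1..n}. {a \<in> A - {x i}. x(i := a) \<in> W})"
  proof (rule inj_onI, clarsimp)
    fix i j a b
    assume "x(i := a) = x(j := b)" "a \<noteq> x i" "b \<noteq> x j"
    then show "i = j \<and> a = b"
      by (metis fun_upd_apply)
  qed
  then have "card {w \<in> W. hamming_adj n x w} =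
      card (SIGMA i:{1..n}. {a \<in> A - {x i}. x(i := a) \<in> W})"
    unfolding neighbours_eq[OF x W] by (rule card_image)
  also have "\<dots> = (\<Sum>i\<in>{1..n}. card {a \<in> A - {x i}. x(i := a) \<in> W})"
    using A by (subst card_SigmaI) auto
  finally show ?thesis .
qed

lemma degree_hamming:
  assumes x: "x \<in> tuples n A" and A: "finite A"
  shows "card {w \<in> tuples n A. hamming_adj n x w} = n * (card A - 1)"
proof -
  have "card {a \<in> A - {x i}. x(i := a) \<in> tuples n A} = card A - 1" if i: "i \<in> {1..n}" for i
  proof -
    have "{a \<in> A - {x i}. x(i := a) \<in> tuples n A} = A - {x i}"
      using tuples_upd[OF x i] by auto
    then show ?thesis using tuples_in[OF x i] A by simp
  qed
  then show ?thesis
    by (simp add: card_neighbours[OF x subset_refl A])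
qed

section \<open>Neighbour counts and equitability of twisted lifts\<close>

lemma card_neighbours_twisted_lift:
  assumes x: "x \<in> tuples n A" and A: "finite A"
    and n: "n \<ge> 2" and \<tau>: "\<tau> \<in> A \<rightarrow> {2..n}"
    and row: "\<And>a. a \<in> A \<Longrightarrow> card {b \<in> A. (a, b) \<in> C} = k"
    and col: "card {a \<in> A. (a, x (\<tau> a)) \<in> C} = k"
  shows "real (card {w \<in> twisted_lift n A \<tau> C. hamming_adj n x w}) =
    (if x \<in> twisted_lift n A \<tau> C then 2 * (real k - 1) + (real n - 2) * (real (card A) - 1)
     else 2 * real k)"
proof -
  let ?D = "twisted_lift n A \<tau> C"
  \<comment> \<open>\<open>d i\<close> is the contribution of position \<open>i\<close>. The
    indicator \<open>e\<close> of membership treats both cases at once: it is the correction for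
    \<open>x\<close> itself, which is not its own neighbour.\<close>
  define d where "d = (\<lambda>i. real (card {a \<in> A - {x i}. x(i := a) \<in> ?D}))"
  define t where "t = \<tau> (x 1)"
  define e :: real where "e = (if x \<in> ?D then 1 else 0)"
  have x1: "x 1 \<in> A" using tuples_in[OF x, of 1] n by simp
  have t: "t \<in> {2..n}" using \<tau> x1 unfolding t_def by blast
  have xt: "x t \<in> A" using tuples_in[OF x, of t] t by simp
  have mem: "x \<in> ?D \<longleftrightarrow> (x 1, x t) \<in> C"
    using x unfolding twisted_lift_def t_def by blast
  \<comment> \<open>\<open>\<tau>\<close> is applied to the first letter after the change, so for
    \<open>i = 1\<close> the second tested position may move as well.\<close>
  have upd: "x(i := a) \<in> ?D \<longleftrightarrow> ((x(i := a)) 1, (x(i := a)) (\<tau> ((x(i := a)) 1))) \<in> C"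
    if "i \<in> {1..n}" "a \<in> A" for i a
    using tuples_upd[OF x that] by (simp add: twisted_lift_def)
  have remove: "real (card (S - {s})) = real (card S) - (if s \<in> S then 1 else 0)"
    if "finite S" for S and s :: 'a
  proof (cases "s \<in> S")
    case True
    then have "card S > 0" using that by (auto simp: card_gt_0_iff)
    then show ?thesis using True that by (simp add: of_nat_diff)
  qed simp
  \<comment> \<open>Changing position 1 therefore leaves the letter at position
    \<open>\<tau> a\<close> intact, and the count is the one in \<open>col\<close>, less
    \<open>x\<close> itself.\<close>
  have "\<tau> a \<noteq> 1" if "a \<in> A" for a
    using funcset_mem[OF \<tau> that] by simp
  then have "{a \<in> A - {x 1}. x(1 := a) \<in> ?D} = {a \<in> A. (a, x (\<tau> a)) \<in> C} - {x 1}"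
    using upd[of 1] n by auto
  then have d1: "d 1 = real k - e"
    unfolding d_def using remove[of "{a \<in> A. (a, x (\<tau> a)) \<in> C}" "x 1"] A col x1 mem
    by (simp add: e_def t_def)
  \<comment> \<open>The first letter is unchanged, so \<open>\<tau>\<close> still selects position
    \<open>t\<close>.\<close>
  have "x(t := a) \<in> ?D \<longleftrightarrow> (x 1, a) \<in> C" if "a \<in> A" for a
    using upd[of t a] that t t_def by auto
  then have "{a \<in> A - {x t}. x(t := a) \<in> ?D} = {b \<in> A. (x 1, b) \<in> C} - {x t}"
    by blast
  then have dt: "d t = real k - e"
    unfolding d_def using remove[of "{b \<in> A. (x 1, b) \<in> C}" "x t"] A row[OF x1] xt mem
    by (simp add: e_def)
  have d0: "d i = (real (card A) - 1) * e" if i: "i \<in> {1..n} - {1, t}" for i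
  proof -
    have "x(i := a) \<in> ?D \<longleftrightarrow> x \<in> ?D" if "a \<in> A" for a
      using upd[of i a] i that mem t_def by auto
    then have "{a \<in> A - {x i}. x(i := a) \<in> ?D} = (if x \<in> ?D then A - {x i} else {})"
      by auto
    then show ?thesis
      unfolding d_def using remove[OF A, of "x i"] tuples_in[OF x, of i] i
      by (auto simp: e_def)
  qed
  have "real (card {w \<in> ?D. hamming_adj n x w}) = (\<Sum>i\<in>{1..n}. d i)"
    unfolding d_def
    by (subst card_neighbours[OF x _ A]) (auto simp: twisted_lift_def)
  also have "\<dots> = (\<Sum>i\<in>{1..n} - {1, t}. d i) + (\<Sum>i\<in>{1, t}. d i)"
    using t by (intro sum.subset_diff) auto
  also have "(\<Sum>i\<in>{1, t}. d i) = 2 * (real k - e)"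
    using d1 dt t by (subst sum.insert) auto
  also have "(\<Sum>i\<in>{1..n} - {1, t}. d i) = real (card ({1..n} - {1, t})) * ((real (card A) - 1) * e)"
    using d0 by simp
  also have "card ({1..n} - {1, t}) = n - 2"
    using t by (subst card_Diff_subset) auto
  finally show ?thesis
    using n by (simp add: e_def of_nat_diff)
qed

lemma twisted_lift_nonempty:
  assumes "(a, b) \<in> C" "a \<in> A" "b \<in> A" and n: "n \<ge> 2" and \<tau>: "\<tau> \<in> A \<rightarrow> {2..n}"
  shows "twisted_lift n A \<tau> C \<noteq> {}"
proof -
  have "\<tau> a \<in> {2..n}" using \<tau> assms(2) by blast
  \<comment> \<open>With \<open>b\<close> at every position but the first, the letter at
    \<open>\<tau> a\<close> is \<open>b\<close> wherever that position is.\<close>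
  then have "(\<lambda>i\<in>{1..n}. if i = 1 then a else b) \<in> twisted_lift n A \<tau> C"
    using assms by (auto simp: twisted_lift_def tuples_def)
  then show ?thesis by blast
qed

text \<open>The matrix does not depend on \<open>\<tau>\<close>; applying this to two choices of
  \<open>\<tau>\<close> with the same \<open>k\<close> is what yields equal quotient
  matrices.\<close>

lemma equitable_twisted_lift:
  assumes A: "finite A" and n: "n \<ge> 2" and \<tau>: "\<tau> \<in> A \<rightarrow> {2..n}"
    and C: "C \<subseteq> A \<times> A" "C \<noteq> {}" "A \<times> A - C \<noteq> {}"
    and row: "\<And>a. a \<in> A \<Longrightarrow> card {b \<in> A. (a, b) \<in> C} = k"
    and col: "\<And>x. x \<in> tuples n A \<Longrightarrow> card {a \<in> A. (a, x (\<tau> a)) \<in> C} = k"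
  shows "equitable_2_partition (tuples n A) (hamming_adj n)
    (twisted_lift n A \<tau> C) (tuples n A - twisted_lift n A \<tau> C) (quotient_matrix n (card A) k)"
proof -
  let ?V = "tuples n A" and ?D = "twisted_lift n A \<tau> C"
  have D: "?D \<subseteq> ?V" by (auto simp: twisted_lift_def)
  obtain a b where ab: "a \<in> A" "b \<in> A" "(a, b) \<in> C" using C by blast
  obtain c d where cd: "c \<in> A" "d \<in> A" "(c, d) \<in> A \<times> A - C" using C by blast
  \<comment> \<open>The second cell contains the lift of the complement of \<open>C\<close>, so one
    nonemptiness lemma serves both cells.\<close>
  have "twisted_lift n A \<tau> (A \<times> A - C) \<subseteq> ?V - ?D"
    by (auto simp: twisted_lift_def)
  then have ne: "?D \<noteq> {}" "?V - ?D \<noteq> {}"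
    using twisted_lift_nonempty[OF ab(3,1,2) n \<tau>] twisted_lift_nonempty[OF cd(3,1,2) n \<tau>]
    by auto
  have "0 < card A" using A ab(1) by (auto simp: card_gt_0_iff)
  then have deg: "real (card {w \<in> ?V. hamming_adj n x w}) = real n * (real (card A) - 1)"
    if "x \<in> ?V" for x
    by (simp add: degree_hamming[OF that A] of_nat_diff)
  have inD: "real (card {w \<in> ?D. hamming_adj n x w}) =
    (if x \<in> ?D then 2 * (real k - 1) + (real n - 2) * (real (card A) - 1) else 2 * real k)"
    if "x \<in> ?V" for x
    by (rule card_neighbours_twisted_lift[OF that A n \<tau> row col[OF that]])
  have outD: "real (card {w \<in> ?V - ?D. hamming_adj n x w}) =
      real n * (real (card A) - 1) - real (card {w \<in> ?D. hamming_adj n x w})" if "x \<in> ?V" for x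
  proof -
    have "{w \<in> ?V - ?D. hamming_adj n x w} =
        {w \<in> ?V. hamming_adj n x w} - {w \<in> ?D. hamming_adj n x w}"
      by blast
    moreover have "{w \<in> ?D. hamming_adj n x w} \<subseteq> {w \<in> ?V. hamming_adj n x w}"
      using D by blast
    moreover have "finite {w \<in> ?V. hamming_adj n x w}"
      using finite_tuples[OF A] by simp
    ultimately show ?thesis
      using deg[OF that] by (simp add: card_Diff_subset card_mono of_nat_diff finite_subset)
  qed
  show ?thesis
    unfolding equitable_2_partition_def
  proof (intro conjI allI ballI)
    fix i j :: 2 and v
    assume v: "v \<in> cell ?D (?V - ?D) i"
    then have "v \<in> ?V" using D by (auto simp: cell_def split: if_splits)
    then show "real (card {w \<in> cell ?D (?V - ?D) j. hamming_adj n v w}) =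
        quotient_matrix n (card A) k $ i $ j"
      using v inD[of v] outD[of v] by (auto simp: cell_def quotient_matrix_def split: if_splits)
  qed (use ne D in auto)
qed

section \<open>The two sets as twisted lifts\<close>

lemma C_plus_eq_twisted_lift: "C_plus n A C = twisted_lift n A (\<lambda>_. 2) C"
  by (simp add: C_plus_def twisted_lift_def)

lemma coord_swap_tuples:
  assumes "x \<in> tuples n A" "i \<in> {1..n-1}"
  shows "coord_swap i x \<in> tuples n A"
proof -
  \<comment> \<open>Since \<open>i + 1\<close> is at most \<open>n\<close>, the transposition
    permutes \<open>{1..n}\<close> and preserves its complement, where the value is
    \<open>undefined\<close>.\<close>
  have tr: "Transposition.transpose 2 (i + 1) j \<in> {1..n} \<longleftrightarrow> j \<in> {1..n}" for j
    using assms(2) by (auto simp: Transposition.transpose_def)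
  then show ?thesis
    using assms(1) by (auto simp: tuples_def coord_swap_def PiE_iff extensional_def simp del: atLeastAtMost_iff)
qed

text \<open>The swap fixes position 1 and carries the letter at position 2 to position
  \<open>i + 1\<close>. By disjointness the first letter determines which swap was applied, so
  \<open>f\<close> can read it off.\<close>

lemma C_plus_pi_eq_twisted_lift:
  assumes n: "n \<ge> 2" and f: "\<And>a. a \<in> A \<Longrightarrow> f a \<in> {1..n-1} \<and> a \<in> P (f a)"
    and disj: "disjoint_family_on P {1..n-1}"
  shows "C_plus_pi n A P C = twisted_lift n A (\<lambda>a. f a + 1) C"
proof (intro equalityI subsetI)
  fix y assume "y \<in> C_plus_pi n A P C"
  then obtain i x where i: "i \<in> {1..n-1}" and x: "x \<in> tuples n A" "x 1 \<in> P i" "(x 1, x 2) \<in> C"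
    and y: "y = coord_swap i x"
    by (auto simp: C_plus_pi_def C_plus_def)
  have "x 1 \<in> A" using tuples_in[OF x(1), of 1] n by simp
  then have "f (x 1) = i"
    using f[of "x 1"] i x(2) disj unfolding disjoint_family_on_def by blast
  moreover have "y 1 = x 1" "y (i + 1) = x 2"
    using i by (auto simp: y coord_swap_def Transposition.transpose_def)
  ultimately show "y \<in> twisted_lift n A (\<lambda>a. f a + 1) C"
    using coord_swap_tuples[OF x(1) i] x(3) y unfolding twisted_lift_def by simp
next
  fix y assume y: "y \<in> twisted_lift n A (\<lambda>a. f a + 1) C"
  define i where "i = f (y 1)"
  \<comment> \<open>The swap is an involution, so the preimage of \<open>y\<close> is its own
    swap.\<close>
  define x where "x = coord_swap i y"
  have yV: "y \<in> tuples n A" and yC: "(y 1, y (i + 1)) \<in> C"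
    using y by (auto simp: twisted_lift_def i_def)
  have "y 1 \<in> A" using tuples_in[OF yV, of 1] n by simp
  then have i: "i \<in> {1..n-1}" and "y 1 \<in> P i" using f[of "y 1"] by (auto simp: i_def)
  moreover have "x 1 = y 1" "x 2 = y (i + 1)"
    using i by (auto simp: x_def coord_swap_def Transposition.transpose_def)
  moreover have "y = coord_swap i x"
    by (simp add: x_def coord_swap_def comp_assoc)
  moreover have "x \<in> tuples n A"
    unfolding x_def by (rule coord_swap_tuples[OF yV i])
  ultimately show "y \<in> C_plus_pi n A P C"
    unfolding C_plus_pi_def C_plus_def using yC
    by (intro UN_I[of i] image_eqI[of _ _ x]) auto
qed

section \<open>From equal densities to equal line counts\<close>

theorem theorem2:
  fixes n q :: nat and A :: "'a set" and P :: "nat \<Rightarrow> 'a set" and C :: "('a \<times> 'a) set"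
  assumes "n \<ge> 2" and "q \<ge> 2" and "finite A" and "card A = q"
    and "\<And>i. i \<in> {1..n-1} \<Longrightarrow> P i \<noteq> {}"
    and "disjoint_family_on P {1..n-1}"
    and "(\<Union>i\<in>{1..n-1}. P i) = A"
    and "C \<subseteq> A \<times> A" and "C \<noteq> {}" and "A \<times> A - C \<noteq> {}"
    and "\<exists>r::real. \<forall>K \<in> {{a} \<times> A |a. a \<in> A} \<union> {P i \<times> {b} |i b. i \<in> {1..n-1} \<and> b \<in> A}.
           real (card (C \<inter> K)) / real (card K) = r"
  shows "\<exists>S. equitable_2_partition (tuples n A) (hamming_adj n)
               (C_plus n A C) (tuples n A - C_plus n A C) S \<and>
             equitable_2_partition (tuples n A) (hamming_adj n)
               (C_plus_pi n A P C) (tuples n A - C_plus_pi n A P C) S \<and>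
             partition_eigenvalue S = (real q - 1) * real n - 2 * real q"
proof -
  note n = assms(1) and A = assms(3) and Pne = assms(5) and disj = assms(6) and UP = assms(7)
  obtain r :: real where r: "\<And>K. K \<in> {{a} \<times> A |a. a \<in> A} \<union> {P i \<times> {b} |i b. i \<in> {1..n-1} \<and> b \<in> A} \<Longrightarrow>
      real (card (C \<inter> K)) / real (card K) = r"
    using assms(11) that by (elim exE) (metis (no_types, lifting))
  have PA: "P i \<subseteq> A" if "i \<in> {1..n-1}" for i using UP that by blast
  have finP: "finite (P i)" if "i \<in> {1..n-1}" for i using PA[OF that] A by (rule finite_subset)
  have row: "real (card {b \<in> A. (a, b) \<in> C}) = r * q" if a: "a \<in> A" for a
  proof -
    have "C \<inter> {a} \<times> A = Pair a ` {b \<in> A. (a, b) \<in> C}" by auto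
    then have "card (C \<inter> {a} \<times> A) = card {b \<in> A. (a, b) \<in> C}"
      by (simp add: card_image inj_on_def)
    moreover have "card ({a} \<times> A) = q" using assms(4) by (simp add: card_cartesian_product)
    moreover have "real (card (C \<inter> {a} \<times> A)) / real (card ({a} \<times> A)) = r"
      using a by (intro r) auto
    ultimately show ?thesis using assms(2) by (auto simp: field_simps)
  qed
  have part: "real (card {a \<in> P i. (a, b) \<in> C}) = r * card (P i)"
    if i: "i \<in> {1..n-1}" and b: "b \<in> A" for i b
  proof -
    have "C \<inter> P i \<times> {b} = (\<lambda>a. (a, b)) ` {a \<in> P i. (a, b) \<in> C}" by auto
    then have "card (C \<inter> P i \<times> {b}) = card {a \<in> P i. (a, b) \<in> C}"
      by (simp add: card_image inj_on_def)
    moreover have "card (P i \<times> {b}) = card (P i)" by (simp add: card_cartesian_product)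
    moreover have "real (card (C \<inter> P i \<times> {b})) / real (card (P i \<times> {b})) = r"
      using i b by (intro r) blast
    moreover have "card (P i) > 0" using Pne[OF i] finP[OF i] by (simp add: card_gt_0_iff)
    ultimately show ?thesis by (auto simp: field_simps)
  qed
  have "\<forall>a\<in>A. \<exists>i. i \<in> {1..n-1} \<and> a \<in> P i" using UP by blast
  then obtain f where f: "\<And>a. a \<in> A \<Longrightarrow> f a \<in> {1..n-1} \<and> a \<in> P (f a)"
    by metis
  have f_eq: "f a = i" if "i \<in> {1..n-1}" "a \<in> P i" for a i
    using f[of a] PA[OF that(1)] that disj unfolding disjoint_family_on_def by blast
  have qsum: "real q = (\<Sum>i\<in>{1..n-1}. real (card (P i)))"
  proof -
    have "card (\<Union>i\<in>{1..n-1}. P i) = (\<Sum>i\<in>{1..n-1}. card (P i))"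
      using disj finP by (intro card_UN_disjoint') auto
    then show ?thesis unfolding UP assms(4) by simp
  qed
  \<comment> \<open>\<open>g\<close> assigns a letter to each part. Each part contributes
    \<open>r\<close> times its size whatever letter it gets, and the sizes add up to
    \<open>q\<close>.\<close>
  have col: "real (card {a \<in> A. (a, g (f a)) \<in> C}) = r * q"
    if g: "\<And>i. i \<in> {1..n-1} \<Longrightarrow> g i \<in> A" for g
  proof -
    have "{a \<in> A. (a, g (f a)) \<in> C} = (\<Union>i\<in>{1..n-1}. {a \<in> P i. (a, g i) \<in> C})"
      using f f_eq PA by blast
    moreover have "disjoint_family_on (\<lambda>i. {a \<in> P i. (a, g i) \<in> C}) {1..n-1}"
      using disj by (rule disjoint_family_on_bisimulation) auto
    ultimately have "card {a \<in> A. (a, g (f a)) \<in> C} =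
        (\<Sum>i\<in>{1..n-1}. card {a \<in> P i. (a, g i) \<in> C})"
      using finP by (simp only:) (intro card_UN_disjoint', auto)
    then have "real (card {a \<in> A. (a, g (f a)) \<in> C}) =
        (\<Sum>i\<in>{1..n-1}. real (card {a \<in> P i. (a, g i) \<in> C}))"
      by simp
    also have "\<dots> = (\<Sum>i\<in>{1..n-1}. r * card (P i))"
      using part g by (intro sum.cong) auto
    finally show ?thesis by (simp add: qsum sum_distrib_left)
  qed
  obtain a0 where a0: "a0 \<in> A" using assms(8,9) by blast
  \<comment> \<open>One row count shows that \<open>r * q\<close> is a natural number; all other
    counts then equal it.\<close>
  define k where "k = card {b \<in> A. (a0, b) \<in> C}"
  have k: "r * q = real k" using row[OF a0] by (simp add: k_def)
  have row': "card {b \<in> A. (a, b) \<in> C} = k" if "a \<in> A" for a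
    using row[OF that] k by simp
  have "(\<lambda>_. 2) \<in> A \<rightarrow> {2..n}" using n by simp
  \<comment> \<open>A constant \<open>g\<close> gives the ordinary columns of
    \<open>C\<close>.\<close>
  moreover have "card {a \<in> A. (a, x 2) \<in> C} = k" if "x \<in> tuples n A" for x
    using col[of "\<lambda>_. x 2"] tuples_in[OF that, of 2] n k by simp
  ultimately have plus: "equitable_2_partition (tuples n A) (hamming_adj n)
      (C_plus n A C) (tuples n A - C_plus n A C) (quotient_matrix n q k)"
    unfolding C_plus_eq_twisted_lift
    using equitable_twisted_lift[OF A n _ assms(8-10) row', of "\<lambda>_. 2"] assms(4) by simp
  have eq: "C_plus_pi n A P C = twisted_lift n A (\<lambda>a. f a + 1) C"
    using n f disj by (rule C_plus_pi_eq_twisted_lift)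
  have "(\<lambda>a. f a + 1) \<in> A \<rightarrow> {2..n}" using f by fastforce
  \<comment> \<open>Here \<open>g i = x (i + 1)\<close>, so each part is met in its own
    column.\<close>
  moreover have "card {a \<in> A. (a, x (f a + 1)) \<in> C} = k" if "x \<in> tuples n A" for x
    using col[of "\<lambda>i. x (i + 1)"] tuples_in[OF that] k by fastforce
  ultimately have pi: "equitable_2_partition (tuples n A) (hamming_adj n)
      (C_plus_pi n A P C) (tuples n A - C_plus_pi n A P C) (quotient_matrix n q k)"
    unfolding eq
    using equitable_twisted_lift[OF A n _ assms(8-10) row', of "\<lambda>a. f a + 1"] assms(4) by simp
  \<comment> \<open>\<open>k\<close> cancels, leaving \<open>(n - 2) * (q - 1) - 2\<close>.\<close>
  have "partition_eigenvalue (quotient_matrix n q k) = (real q - 1) * real n - 2 * real q"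
    by (simp add: partition_eigenvalue_def quotient_matrix_def algebra_simps)
  with plus pi show ?thesis by blast
qed

end
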